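(* Let $f\in L^1(\mathbb{R}^d)$, $1\le p\le\infty$, and let $G\colon\mathbb{R}^d\times\mathbb{R}^d\to\mathbb{R}$ be measurable such that $\|G(\cdot,y)\|_p\le\Gamma$ for all $y\in\mathbb{R}^d$, for some $\Gamma\ge 0$ independent of $y$. Then $$\|f\,\bar\ast\,G\|_p\le\|f\|_1\,\Gamma .$$
   Context: For measurable $f\colon\mathbb{R}^d\to\mathbb{R}$ and $G\colon\mathbb{R}^d\times\mathbb{R}^d\to\mathbb{R}$, the generalized convolution is $$(f\,\bar\ast\,G)(x):=\int_{\mathbb{R}^d} f(y)\,G(x,y)\,dy,$$ whenever the integral is well-defined. $\|\cdot\|_p$ denotes the norm of $L^p(\mathbb{R}^d)$ with respect to Lebesgue measure. *)

theory Defs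
  imports "HOL-Analysis.Analysis" "HOL-Probability.Essential_Supremum"
begin

(* The norm of L^p with respect to Lebesgue measure, for an exponent p in [1, \<infinity>].
   It is \<infinity> for functions that are not Lebesgue measurable (following the library's
   convention for esssup), so a finite norm means membership in L^p and in particular
   measurability.  The case distinction on I is the extension of the 1/p-th power
   to [0, \<infinity>]. *)
definition Lp_norm :: "ennreal \<Rightarrow> ('a::euclidean_space \<Rightarrow> real) \<Rightarrow> ennreal" where
  "Lp_norm p f =
     (if f \<notin> borel_measurable lebesgue then \<infinity>
      else if p = \<infinity> then esssup lebesgue (\<lambda>x. ennreal \<bar>f x\<bar>)
      else let I = (\<integral>\<^sup>+ x. ennreal (\<bar>f x\<bar> powr enn2real p) \<partial>lebesgue)
           in if I = \<infinity> then \<infinity> else ennreal (enn2real I powr (1 / enn2real p)))"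

(* At a point x where the integrand is not integrable, the Bochner integral (and hence
   gen_conv f G x) is 0 by convention; gen_conv_defined singles out the points where
   the integral is well-defined. *)
definition gen_conv :: "('a::euclidean_space \<Rightarrow> real) \<Rightarrow> ('a \<times> 'a \<Rightarrow> real) \<Rightarrow> 'a \<Rightarrow> real" where
  "gen_conv f G x = (\<integral>y. f y * G (x, y) \<partial>lebesgue)"

definition gen_conv_defined :: "('a::euclidean_space \<Rightarrow> real) \<Rightarrow> ('a \<times> 'a \<Rightarrow> real) \<Rightarrow> 'a \<Rightarrow> bool" where
  "gen_conv_defined f G x \<longleftrightarrow> integrable lebesgue (\<lambda>y. f y * G (x, y))"

end

theory Submission
  imports Defs
begin

text \<open>
  The inequality is Minkowski's integral inequality: the convolution is an average of the functions
  \<open>G (\<cdot>, y)\<close>, all of norm at most \<open>\<Gamma>\<close>, with signed weights \<open>f y\<close> of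
  total variation \<open>\<parallel>f\<parallel>\<^sub>1\<close>.  Write \<open>A = \<parallel>f\<parallel>\<^sub>1\<close>.

  For \<open>p < \<infinity>\<close>, Jensen's inequality for the measure with density \<open>\<bar>f\<bar>\<close>
  (\<open>weighted_jensen_powr\<close>) bounds the \<open>p\<close>-th power of the inner integral by
  \<open>A powr (p - 1)\<close> times the integral of \<open>\<bar>f y\<bar> * \<bar>G (x, y)\<bar> powr p\<close> over \<open>y\<close>.
  Integrating over \<open>x\<close> and exchanging the integrals by Tonelli's theorem brings
  in the norms of the sections \<open>G (\<cdot>, y)\<close>, and one more factor \<open>A\<close> comes out.  The double
  integral being finite, the inner integral is finite for almost every \<open>x\<close>, which is why the
  convolution is defined almost everywhere (\<open>generalized_Young_finite_exponent\<close>).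

  For \<open>p = \<infinity>\<close>, the two quantifiers in "for almost every \<open>y\<close>, \<open>\<bar>G (x, y)\<bar> \<le> \<Gamma>\<close> for almost every
  \<open>x\<close>" may be exchanged by Fubini's theorem for null sets, and the integrand is then dominated by
  \<open>\<Gamma> \<bar>f\<bar>\<close> (\<open>generalized_Young_infinite_exponent\<close>).

  Both arguments need a kernel that is measurable for the product sigma-algebra.  A Lebesgue
  measurable \<open>G\<close> is only measurable for the completion of the product measure, so \<open>f\<close> and \<open>G\<close>
  are first replaced by Borel functions that agree with them almost everywhere.  By Fubini's
  theorem almost all sections of \<open>G\<close>, in either direction, change only on null sets; hence the norm
  bound persists for almost every \<open>y\<close>, and the convolution changes only on a null set of \<open>x\<close>.
\<close>

section \<open>Jensen's inequality for a weight\<close>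

text \<open>
  A convex function lies above its tangents.  Dividing by \<open>m\<close> reduces this to the tangent at
  \<open>1\<close>, which is Young's inequality for \<open>s powr p\<close> and \<open>1\<close> with exponents \<open>1 / p\<close> and \<open>1 - 1 / p\<close>.
\<close>

lemma powr_ge_tangent:
  fixes t m p :: real
  assumes "1 \<le> p" "0 \<le> t" "0 < m"
  shows "m powr p + p * m powr (p - 1) * (t - m) \<le> t powr p"
proof -
  have unit: "1 + p * (s - 1) \<le> s powr p" if "0 \<le> s" for s :: real
  proof (cases "s = 0")
    case False
    with that have "(s powr p) powr (1 / p) * 1 powr (1 - 1 / p) \<le> 1 / p * (s powr p) + (1 - 1 / p) * 1"
      using assms(1) by (intro Youngs_inequality_0) auto
    then have "s \<le> s powr p / p + (1 - 1 / p)"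
      using assms(1) that by (simp add: powr_powr)
    then have "p * s \<le> p * (s powr p / p + (1 - 1 / p))"
      using assms(1) by (intro mult_left_mono) auto
    then show ?thesis
      using assms(1) by (simp add: algebra_simps)
  qed (use assms(1) in simp)
  have "m powr p * (1 + p * (t / m - 1)) \<le> m powr p * (t / m) powr p"
    using unit[of "t / m"] assms by (intro mult_left_mono) auto
  also have "\<dots> = t powr p"
    using assms by (simp add: powr_divide)
  also have "m powr p * (1 + p * (t / m - 1)) = m powr p + p * (m powr p / m) * (t - m)"
    using assms by (simp add: field_simps)
  also have "m powr p / m = m powr (p - 1)"
    using assms by (simp add: powr_diff)
  finally show ?thesis .
qed

text \<open>
  Integrating the tangent inequality at the weighted mean \<open>m\<close> of \<open>\<bar>g\<bar>\<close> against the weight \<open>\<bar>f\<bar>\<close>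
  gives Jensen's inequality; it appears here without the normalization of the weight to total
  mass \<open>1\<close>.  The product \<open>f g\<close> is integrable because \<open>\<bar>g\<bar> \<le> 1 + \<bar>g\<bar> powr p\<close>.
\<close>

lemma weighted_jensen_powr:
  fixes f g :: "'b \<Rightarrow> real" and p :: real
  assumes p: "1 \<le> p"
    and f: "integrable M f"
    and g[measurable]: "g \<in> borel_measurable M"
    and fg: "integrable M (\<lambda>y. \<bar>f y\<bar> * \<bar>g y\<bar> powr p)"
  shows "integrable M (\<lambda>y. f y * g y)"
    and "\<bar>\<integral>y. f y * g y \<partial>M\<bar> powr p
           \<le> (\<integral>y. \<bar>f y\<bar> \<partial>M) powr (p - 1) * (\<integral>y. \<bar>f y\<bar> * \<bar>g y\<bar> powr p \<partial>M)"
proof -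
  have [measurable]: "f \<in> borel_measurable M"
    using f by (rule borel_measurable_integrable)
  have le: "\<bar>g y\<bar> \<le> 1 + \<bar>g y\<bar> powr p" for y
  proof (cases "\<bar>g y\<bar> \<le> 1")
    case True
    then show ?thesis
      using powr_ge_zero[of "\<bar>g y\<bar>" p] by linarith
  next
    case False
    then show ?thesis
      using powr_mono[of 1 p "\<bar>g y\<bar>"] p by simp
  qed
  show int: "integrable M (\<lambda>y. f y * g y)"
  proof (rule Bochner_Integration.integrable_bound)
    show "integrable M (\<lambda>y. \<bar>f y\<bar> + \<bar>f y\<bar> * \<bar>g y\<bar> powr p)"
      using f fg by auto
    have "\<bar>f y\<bar> * \<bar>g y\<bar> \<le> \<bar>f y\<bar> * (1 + \<bar>g y\<bar> powr p)" for y
      using le by (rule mult_left_mono) simp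
    then show "AE y in M. norm (f y * g y) \<le> norm (\<bar>f y\<bar> + \<bar>f y\<bar> * \<bar>g y\<bar> powr p)"
      by (simp add: abs_mult distrib_left)
  qed simp
  define A where "A = (\<integral>y. \<bar>f y\<bar> \<partial>M)"
  define B where "B = (\<integral>y. \<bar>f y * g y\<bar> \<partial>M)"
  define J where "J = (\<integral>y. \<bar>f y\<bar> * \<bar>g y\<bar> powr p \<partial>M)"
  have [simp]: "0 \<le> A" "0 \<le> B" "0 \<le> J"
    by (simp_all add: A_def B_def J_def)
  have B: "\<bar>\<integral>y. f y * g y \<partial>M\<bar> \<le> B"
    unfolding B_def by (rule integral_abs_bound)
  have "B powr p \<le> A powr (p - 1) * J"
  proof (cases "B = 0")
    case False
    have "A \<noteq> 0"
    proof
      assume "A = 0"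
      then have "AE y in M. \<bar>f y\<bar> = 0"
        unfolding A_def using f by (subst (asm) integral_nonneg_eq_0_iff_AE) auto
      then have "AE y in M. \<bar>f y * g y\<bar> = 0"
        by eventually_elim auto
      then have "B = 0"
        unfolding B_def by (rule integral_eq_zero_AE)
      with False show False ..
    qed
    then have "0 < A" "0 < B"
      using False by (auto simp: order_less_le)
    define m where "m = B / A"
    have m: "0 < m"
      using \<open>0 < A\<close> \<open>0 < B\<close> by (simp add: m_def)
    have "m powr p * A + p * m powr (p - 1) * (B - m * A)
        = (\<integral>y. m powr p * \<bar>f y\<bar> + p * m powr (p - 1) * (\<bar>f y * g y\<bar> - m * \<bar>f y\<bar>) \<partial>M)"
      using f int by (simp add: A_def B_def)
    also have "\<dots> \<le> J"
      unfolding J_def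
    proof (rule integral_mono)
      fix y
      have "\<bar>f y\<bar> * (m powr p + p * m powr (p - 1) * (\<bar>g y\<bar> - m)) \<le> \<bar>f y\<bar> * \<bar>g y\<bar> powr p"
        using p m by (intro mult_left_mono powr_ge_tangent) auto
      then show "m powr p * \<bar>f y\<bar> + p * m powr (p - 1) * (\<bar>f y * g y\<bar> - m * \<bar>f y\<bar>)
          \<le> \<bar>f y\<bar> * \<bar>g y\<bar> powr p"
        by (simp add: abs_mult algebra_simps)
    qed (use f int fg in auto)
    \<comment> \<open>The linear term vanishes because the tangent is taken at the mean value.\<close>
    finally have "m powr p * A \<le> J"
      using \<open>0 < A\<close> by (simp add: m_def)
    then have "A powr (p - 1) * (m powr p * A) \<le> A powr (p - 1) * J"
      by (intro mult_left_mono) auto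
    also have "A powr (p - 1) * (m powr p * A) = (A * m) powr p"
      using \<open>0 < A\<close> m by (simp add: powr_mult powr_diff)
    also have "A * m = B"
      using \<open>0 < A\<close> by (simp add: m_def)
    finally show ?thesis .
  qed (use p in simp)
  then show "\<bar>\<integral>y. f y * g y \<partial>M\<bar> powr p
           \<le> (\<integral>y. \<bar>f y\<bar> \<partial>M) powr (p - 1) * (\<integral>y. \<bar>f y\<bar> * \<bar>g y\<bar> powr p \<partial>M)"
    using powr_mono2[OF _ _ B, of p] p by (simp add: A_def J_def)
qed

section \<open>The bound on a product of sigma-finite measures\<close>

context pair_sigma_finite
begin

text \<open>
  Fubini for null sets with the second coordinate outermost.  The exceptional set of \<open>Q\<close> need not
  be measurable, so the quantifiers are exchanged for a measurable null set covering it.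
\<close>

lemma AE_pair_swap:
  assumes "AE z in M1 \<Otimes>\<^sub>M M2. Q z"
  shows "AE y in M2. AE x in M1. Q (x, y)"
proof -
  obtain N where N: "{z \<in> space (M1 \<Otimes>\<^sub>M M2). \<not> Q z} \<subseteq> N" "N \<in> null_sets (M1 \<Otimes>\<^sub>M M2)"
    using assms unfolding eventually_ae_filter by auto
  then have [measurable]: "N \<in> sets (M1 \<Otimes>\<^sub>M M2)"
    by auto
  have "AE x in M1. AE y in M2. (x, y) \<notin> N"
    using AE_not_in[OF N(2)] by (rule AE_pair)
  then have "AE y in M2. AE x in M1. (x, y) \<notin> N"
    by (subst (asm) AE_commute) auto
  then show ?thesis
    using AE_space
  proof eventually_elim
    case (elim y)
    from elim(1) AE_space show ?case
      by eventually_elim (use N(1) elim(2) in \<open>auto simp: space_pair_measure\<close>)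
  qed
qed

text \<open>
  Jensen's inequality in \<open>y\<close> followed by Tonelli's theorem.  The auxiliary function \<open>J\<close> has finite
  integral, hence is finite almost everywhere, and this finiteness is exactly the integrability
  that Jensen's inequality presupposes at \<open>x\<close>.
\<close>

lemma generalized_Young_finite_exponent:
  fixes f :: "'b \<Rightarrow> real" and G :: "'a \<times> 'b \<Rightarrow> real" and p C :: real
  assumes p: "1 \<le> p"
    and f: "integrable M2 f"
    and G[measurable]: "G \<in> borel_measurable (M1 \<Otimes>\<^sub>M M2)"
    and bound: "AE y in M2. (\<integral>\<^sup>+x. ennreal (\<bar>G (x, y)\<bar> powr p) \<partial>M1) \<le> ennreal C"
  shows "AE x in M1. integrable M2 (\<lambda>y. f y * G (x, y))"
    and "(\<integral>\<^sup>+x. ennreal (\<bar>\<integral>y. f y * G (x, y) \<partial>M2\<bar> powr p) \<partial>M1)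
           \<le> ennreal ((\<integral>y. \<bar>f y\<bar> \<partial>M2) powr p) * ennreal C"
proof -
  have [measurable]: "f \<in> borel_measurable M2"
    using f by (rule borel_measurable_integrable)
  define A where "A = (\<integral>y. \<bar>f y\<bar> \<partial>M2)"
  have A: "0 \<le> A" "(\<integral>\<^sup>+y. ennreal \<bar>f y\<bar> \<partial>M2) = ennreal A"
    using f by (auto simp: A_def nn_integral_eq_integral)
  define J where "J x = (\<integral>\<^sup>+y. ennreal (\<bar>f y\<bar> * \<bar>G (x, y)\<bar> powr p) \<partial>M2)" for x
  have [measurable]: "J \<in> borel_measurable M1"
    unfolding J_def by measurable
  have "(\<integral>\<^sup>+x. J x \<partial>M1) = (\<integral>\<^sup>+y. \<integral>\<^sup>+x. ennreal (\<bar>f y\<bar> * \<bar>G (x, y)\<bar> powr p) \<partial>M1 \<partial>M2)"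
    unfolding J_def by (rule Fubini'[symmetric]) measurable
  also have "\<dots> = (\<integral>\<^sup>+y. ennreal \<bar>f y\<bar> * (\<integral>\<^sup>+x. ennreal (\<bar>G (x, y)\<bar> powr p) \<partial>M1) \<partial>M2)"
    by (intro nn_integral_cong) (simp add: ennreal_mult nn_integral_cmult)
  also have "\<dots> \<le> (\<integral>\<^sup>+y. ennreal \<bar>f y\<bar> * ennreal C \<partial>M2)"
    using bound by (intro nn_integral_mono_AE) (auto elim!: eventually_mono intro: mult_left_mono)
  also have "\<dots> = ennreal A * ennreal C"
    by (simp add: nn_integral_multc A)
  finally have J_le: "(\<integral>\<^sup>+x. J x \<partial>M1) \<le> ennreal A * ennreal C" .
  also have "\<dots> < \<infinity>"
    by (simp add: ennreal_mult_less_top)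
  finally have "AE x in M1. J x \<noteq> \<infinity>"
    by (intro nn_integral_PInf_AE) auto
  then have pointwise: "AE x in M1. integrable M2 (\<lambda>y. f y * G (x, y)) \<and>
      ennreal (\<bar>\<integral>y. f y * G (x, y) \<partial>M2\<bar> powr p) \<le> ennreal (A powr (p - 1)) * J x"
    using AE_space
  proof eventually_elim
    case (elim x)
    have sec[measurable]: "(\<lambda>y. G (x, y)) \<in> borel_measurable M2"
      using elim(2) by measurable
    have int: "integrable M2 (\<lambda>y. \<bar>f y\<bar> * \<bar>G (x, y)\<bar> powr p)"
      using elim(1) by (intro integrableI_nonneg) (auto simp: J_def less_top)
    have J: "J x = ennreal (\<integral>y. \<bar>f y\<bar> * \<bar>G (x, y)\<bar> powr p \<partial>M2)"
      unfolding J_def using int by (intro nn_integral_eq_integral) auto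
    show ?case
      using weighted_jensen_powr[OF p f sec int]
      by (auto simp: J A_def ennreal_mult[symmetric] intro!: ennreal_leI)
  qed
  then show "AE x in M1. integrable M2 (\<lambda>y. f y * G (x, y))"
    by eventually_elim blast
  have "(\<integral>\<^sup>+x. ennreal (\<bar>\<integral>y. f y * G (x, y) \<partial>M2\<bar> powr p) \<partial>M1)
      \<le> (\<integral>\<^sup>+x. ennreal (A powr (p - 1)) * J x \<partial>M1)"
    using pointwise by (intro nn_integral_mono_AE) (auto elim: eventually_mono)
  also have "\<dots> \<le> ennreal (A powr (p - 1)) * (ennreal A * ennreal C)"
    by (subst nn_integral_cmult) (auto intro: mult_left_mono J_le)
  also have "\<dots> = ennreal (A powr p) * ennreal C"
    using A(1) p by (cases "A = 0") (auto simp: mult.assoc[symmetric] ennreal_mult[symmetric] powr_diff)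
  finally show "(\<integral>\<^sup>+x. ennreal (\<bar>\<integral>y. f y * G (x, y) \<partial>M2\<bar> powr p) \<partial>M1)
           \<le> ennreal ((\<integral>y. \<bar>f y\<bar> \<partial>M2) powr p) * ennreal C"
    by (simp add: A_def)
qed

lemma generalized_Young_infinite_exponent:
  fixes f :: "'b \<Rightarrow> real" and G :: "'a \<times> 'b \<Rightarrow> real" and C :: real
  assumes f: "integrable M2 f"
    and G[measurable]: "G \<in> borel_measurable (M1 \<Otimes>\<^sub>M M2)"
    and bound: "AE y in M2. AE x in M1. \<bar>G (x, y)\<bar> \<le> C"
  shows "AE x in M1. integrable M2 (\<lambda>y. f y * G (x, y)) \<and>
           \<bar>\<integral>y. f y * G (x, y) \<partial>M2\<bar> \<le> (\<integral>y. \<bar>f y\<bar> \<partial>M2) * C"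
proof -
  have [measurable]: "f \<in> borel_measurable M2"
    using f by (rule borel_measurable_integrable)
  have "AE x in M1. AE y in M2. \<bar>G (x, y)\<bar> \<le> C"
    using bound by (subst AE_commute) measurable
  then show ?thesis
    using AE_space
  proof eventually_elim
    case (elim x)
    have [measurable]: "(\<lambda>y. G (x, y)) \<in> borel_measurable M2"
      using elim(2) by measurable
    have le: "AE y in M2. \<bar>f y * G (x, y)\<bar> \<le> \<bar>f y\<bar> * C"
      using elim(1) by eventually_elim (simp add: abs_mult mult_left_mono)
    have int: "integrable M2 (\<lambda>y. f y * G (x, y))"
    proof (rule Bochner_Integration.integrable_bound)
      show "integrable M2 (\<lambda>y. \<bar>f y\<bar> * C)"
        using f by simp
      show "AE y in M2. norm (f y * G (x, y)) \<le> norm (\<bar>f y\<bar> * C)"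
        using le by eventually_elim simp
    qed simp
    have "\<bar>\<integral>y. f y * G (x, y) \<partial>M2\<bar> \<le> (\<integral>y. \<bar>f y * G (x, y)\<bar> \<partial>M2)"
      by (rule integral_abs_bound)
    also have "\<dots> \<le> (\<integral>y. \<bar>f y\<bar> * C \<partial>M2)"
      using int f le by (intro integral_mono_AE) auto
    finally show ?case
      using int by simp
  qed
qed

end

section \<open>The norm in terms of integrals and pointwise bounds\<close>

text \<open>
  Raising a norm bound to the power \<open>p\<close> turns it into a bound on an integral, the form in which
  the results on product measures are stated.
\<close>

lemma Lp_norm_finite_le_iff:
  fixes p :: ennreal and h :: "'a::euclidean_space \<Rightarrow> real"
  assumes "1 \<le> p" "p \<noteq> \<infinity>" "0 \<le> C"
  shows "Lp_norm p h \<le> ennreal C \<longleftrightarrow> h \<in> borel_measurable lebesgue \<and>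
    (\<integral>\<^sup>+x. ennreal (\<bar>h x\<bar> powr enn2real p) \<partial>lebesgue) \<le> ennreal (C powr enn2real p)"
proof -
  define q where "q = enn2real p"
  have q: "1 \<le> q"
    using assms unfolding q_def by (cases p) (auto simp flip: ennreal_1)
  have "ennreal (r powr (1 / q)) \<le> ennreal C \<longleftrightarrow> ennreal r \<le> ennreal (C powr q)" if "0 \<le> r" for r
  proof -
    have "r powr (1 / q) \<le> C \<longleftrightarrow> (r powr (1 / q)) powr q \<le> C powr q"
      using q assms(3) powr_mono2[of q "r powr (1 / q)" C] powr_less_mono2[of q C "r powr (1 / q)"]
      by (auto simp flip: not_less)
    also have "(r powr (1 / q)) powr q = r"
      using q that by (simp add: powr_powr)
    finally show ?thesis
      using assms(3) by simp
  qed
  then show ?thesis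
    using assms(2) unfolding Lp_norm_def Let_def q_def[symmetric]
    by (cases "\<integral>\<^sup>+x. ennreal (\<bar>h x\<bar> powr q) \<partial>lebesgue") (auto simp: top_unique)
qed

lemma Lp_norm_infinity_le_iff:
  fixes h :: "'a::euclidean_space \<Rightarrow> real"
  assumes "0 \<le> C"
  shows "Lp_norm \<infinity> h \<le> ennreal C \<longleftrightarrow> h \<in> borel_measurable lebesgue \<and> (AE x in lebesgue. \<bar>h x\<bar> \<le> C)"
proof (cases "h \<in> borel_measurable lebesgue")
  case True
  then have "esssup lebesgue (\<lambda>x. ennreal \<bar>h x\<bar>) \<le> ennreal C \<longleftrightarrow> (AE x in lebesgue. ennreal \<bar>h x\<bar> \<le> ennreal C)"
    using esssup_AE[of "\<lambda>x. ennreal \<bar>h x\<bar>" lebesgue] by (auto elim: eventually_mono)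
  with True assms show ?thesis
    by (simp add: Lp_norm_def)
qed (simp add: Lp_norm_def top_unique)

lemma Lp_norm_one:
  assumes "integrable lebesgue f"
  shows "Lp_norm 1 f = ennreal (\<integral>x. \<bar>f x\<bar> \<partial>lebesgue)"
proof -
  have "(\<integral>\<^sup>+x. ennreal \<bar>f x\<bar> \<partial>lebesgue) = ennreal (\<integral>x. \<bar>f x\<bar> \<partial>lebesgue)"
    using assms by (intro nn_integral_eq_integral) auto
  then show ?thesis
    using borel_measurable_integrable[OF assms] by (simp add: Lp_norm_def)
qed

lemma Lp_norm_le_AE_cong:
  assumes "AE x in lebesgue. g x = h x" "Lp_norm p g \<le> ennreal C"
  shows "Lp_norm p h \<le> ennreal C"
proof -
  have g: "g \<in> borel_measurable lebesgue"
    using assms(2) by (auto simp: Lp_norm_def top_unique split: if_splits)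
  have h: "h \<in> borel_measurable lebesgue"
    using g assms(1) by (rule borel_measurable_AE)
  have "esssup lebesgue (\<lambda>x. ennreal \<bar>g x\<bar>) = esssup lebesgue (\<lambda>x. ennreal \<bar>h x\<bar>)"
    using g h assms(1) by (intro esssup_AE_cong) auto
  moreover have "(\<integral>\<^sup>+x. ennreal (\<bar>g x\<bar> powr enn2real p) \<partial>lebesgue) = (\<integral>\<^sup>+x. ennreal (\<bar>h x\<bar> powr enn2real p) \<partial>lebesgue)"
    using assms(1) by (intro nn_integral_cong_AE) (auto elim: eventually_mono)
  ultimately show ?thesis
    using assms(2) g h unfolding Lp_norm_def by (simp only: if_True not_True_eq_False if_False simp_thms)
qed

section \<open>Borel representatives\<close>

text \<open>
  For Borel functions the results on product measures apply directly, since the product of two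
  copies of \<^const>\<open>lborel\<close> is again \<^const>\<open>lborel\<close>; this fails for the completed measures.
\<close>

lemma Lp_norm_integral_Borel_kernel_le:
  fixes f :: "'a::euclidean_space \<Rightarrow> real" and G :: "'a \<times> 'a \<Rightarrow> real"
  assumes f: "integrable lborel f"
    and G[measurable]: "G \<in> borel_measurable borel"
    and p: "1 \<le> p" and \<Gamma>: "0 \<le> \<Gamma>"
    and bound: "AE y in lborel. Lp_norm p (\<lambda>x. G (x, y)) \<le> ennreal \<Gamma>"
  shows "AE x in lborel. integrable lborel (\<lambda>y. f y * G (x, y))"
    and "Lp_norm p (\<lambda>x. \<integral>y. f y * G (x, y) \<partial>lborel) \<le> ennreal ((\<integral>y. \<bar>f y\<bar> \<partial>lborel) * \<Gamma>)"
proof -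
  have [measurable]: "f \<in> borel_measurable borel"
    using borel_measurable_integrable[OF f] by simp
  have G2: "G \<in> borel_measurable (lborel \<Otimes>\<^sub>M lborel)"
    by (simp add: lborel_prod)
  let ?h = "\<lambda>x. \<integral>y. f y * G (x, y) \<partial>lborel"
  have "?h \<in> borel_measurable lborel"
    using G2 by measurable
  then have h: "?h \<in> borel_measurable lebesgue"
    by (rule measurable_completion)
  have A: "0 \<le> (\<integral>y. \<bar>f y\<bar> \<partial>lborel) * \<Gamma>"
    using \<Gamma> by simp
  have "(AE x in lborel. integrable lborel (\<lambda>y. f y * G (x, y))) \<and>
      Lp_norm p ?h \<le> ennreal ((\<integral>y. \<bar>f y\<bar> \<partial>lborel) * \<Gamma>)"
  proof (cases "p = \<infinity>")
    case True
    have "AE y in lborel. AE x in lborel. \<bar>G (x, y)\<bar> \<le> \<Gamma>"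
      using bound unfolding True Lp_norm_infinity_le_iff[OF \<Gamma>] AE_completion_iff
      by eventually_elim blast
    from lborel_pair.generalized_Young_infinite_exponent[OF f G2 this]
    show ?thesis
      unfolding True Lp_norm_infinity_le_iff[OF A] AE_completion_iff
      using h by (auto elim: eventually_mono)
  next
    case False
    have q: "1 \<le> enn2real p"
      using p False by (cases p) (auto simp flip: ennreal_1)
    have "AE y in lborel. (\<integral>\<^sup>+x. ennreal (\<bar>G (x, y)\<bar> powr enn2real p) \<partial>lborel) \<le> ennreal (\<Gamma> powr enn2real p)"
      using bound unfolding Lp_norm_finite_le_iff[OF p False \<Gamma>] nn_integral_completion
      by eventually_elim blast
    from lborel_pair.generalized_Young_finite_exponent[OF q f G2 this]
    show ?thesis
      unfolding Lp_norm_finite_le_iff[OF p False A] nn_integral_completion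
      using h \<Gamma> by (simp add: powr_mult ennreal_mult)
  qed
  then show "AE x in lborel. integrable lborel (\<lambda>y. f y * G (x, y))"
    "Lp_norm p ?h \<le> ennreal ((\<integral>y. \<bar>f y\<bar> \<partial>lborel) * \<Gamma>)"
    by auto
qed

text \<open>
  Measurability of \<open>g\<close> is a consequence here, by completeness of the Lebesgue measure.  This matters
  for the sections \<open>G (x, \<cdot>)\<close> of a Lebesgue measurable kernel, which are known to be measurable only because
  almost all of them agree almost everywhere with a Borel section.
\<close>

lemma lebesgue_integral_Borel_representative:
  fixes g g' :: "'a::euclidean_space \<Rightarrow> real"
  assumes g': "g' \<in> borel_measurable borel" and eq: "AE x in lborel. g x = g' x"
  shows "integrable lebesgue g \<longleftrightarrow> integrable lborel g'"
    and "integral\<^sup>L lebesgue g = integral\<^sup>L lborel g'"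
proof -
  have m': "g' \<in> borel_measurable lebesgue"
    using g' by (simp add: measurable_completion)
  have eq': "AE x in lebesgue. g' x = g x"
    using eq unfolding AE_completion_iff by eventually_elim simp
  have m: "g \<in> borel_measurable lebesgue"
    using m' eq' by (rule borel_measurable_AE)
  show "integrable lebesgue g \<longleftrightarrow> integrable lborel g'"
    using integrable_cong_AE[OF m' m eq'] integrable_completion[of g' lborel] g' by simp
  show "integral\<^sup>L lebesgue g = integral\<^sup>L lborel g'"
    using integral_cong_AE[OF m' m eq'] integral_completion[of g' lborel] g' by simp
qed

theorem theorem5:
  fixes f :: "'a::euclidean_space \<Rightarrow> real"
    and G :: "'a \<times> 'a \<Rightarrow> real"
    and p :: ennreal
    and \<Gamma> :: real
  assumes "integrable lebesgue f"
    and "1 \<le> p"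
    and "G \<in> borel_measurable lebesgue"
    and "\<Gamma> \<ge> 0"
    and "\<And>y. Lp_norm p (\<lambda>x. G (x, y)) \<le> ennreal \<Gamma>"
  shows "(AE x in lebesgue. gen_conv_defined f G x) \<and>
         Lp_norm p (gen_conv f G) \<le> Lp_norm 1 f * ennreal \<Gamma>"
proof -
  obtain f' where f'[measurable]: "f' \<in> borel_measurable borel" and ff': "AE y in lborel. f y = f' y"
    using completion_ex_borel_measurable_real[OF borel_measurable_integrable[OF assms(1)]] by auto
  obtain G' where G'[measurable]: "G' \<in> borel_measurable borel" and GG': "AE z in lborel. G z = G' z"
    using completion_ex_borel_measurable_real[OF assms(3)] by auto
  have GG'_pair: "AE z in lborel \<Otimes>\<^sub>M lborel. G z = G' z"
    unfolding lborel_prod by (rule GG')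
  have f'_int: "integrable lborel f'"
    using assms(1) lebesgue_integral_Borel_representative(1)[OF f' ff'] by simp
  have norm_f: "Lp_norm 1 f = ennreal (\<integral>y. \<bar>f' y\<bar> \<partial>lborel)"
    unfolding Lp_norm_one[OF assms(1)] using ff'
    by (intro arg_cong[of _ _ ennreal] lebesgue_integral_Borel_representative(2)) (auto elim: eventually_mono)
  have "AE y in lborel. AE x in lborel. G (x, y) = G' (x, y)"
    using GG'_pair by (rule lborel_pair.AE_pair_swap)
  then have bound: "AE y in lborel. Lp_norm p (\<lambda>x. G' (x, y)) \<le> ennreal \<Gamma>"
  proof eventually_elim
    case (elim y)
    then have "AE x in lebesgue. G (x, y) = G' (x, y)"
      unfolding AE_completion_iff .
    then show ?case
      using assms(5)[of y] by (rule Lp_norm_le_AE_cong)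
  qed
  note Borel = Lp_norm_integral_Borel_kernel_le[OF f'_int G' assms(2,4) bound]
  have "AE x in lborel. AE y in lborel. G (x, y) = G' (x, y)"
    using GG'_pair by (rule lborel_pair.AE_pair)
  then have agree: "AE x in lborel. (gen_conv_defined f G x \<longleftrightarrow> integrable lborel (\<lambda>y. f' y * G' (x, y))) \<and>
      gen_conv f G x = (\<integral>y. f' y * G' (x, y) \<partial>lborel)"
  proof eventually_elim
    case (elim x)
    have eq: "AE y in lborel. f y * G (x, y) = f' y * G' (x, y)"
      using elim ff' by eventually_elim simp
    have "(\<lambda>y. f' y * G' (x, y)) \<in> borel_measurable borel"
      by measurable
    from lebesgue_integral_Borel_representative[OF this eq] show ?case
      by (simp add: gen_conv_def gen_conv_defined_def)
  qed
  show ?thesis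
  proof
    show "AE x in lebesgue. gen_conv_defined f G x"
      unfolding AE_completion_iff using agree Borel(1) by eventually_elim blast
    have "Lp_norm p (gen_conv f G) \<le> ennreal ((\<integral>y. \<bar>f' y\<bar> \<partial>lborel) * \<Gamma>)"
    proof (rule Lp_norm_le_AE_cong[OF _ Borel(2)])
      show "AE x in lebesgue. (\<integral>y. f' y * G' (x, y) \<partial>lborel) = gen_conv f G x"
        unfolding AE_completion_iff using agree by eventually_elim simp
    qed
    then show "Lp_norm p (gen_conv f G) \<le> Lp_norm 1 f * ennreal \<Gamma>"
      using assms(4) by (simp add: norm_f ennreal_mult)
  qed
qed

end
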